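(* Let $s\in\mathbb{N}$, $l\in\mathbb{N}$, $k_1,\dots,k_l,t_1,\dots,t_l\in\mathbb{N}'$ and $m_1,\dots,m_l\in\mathbb{Z}$, and put $K=k_1t_1+\cdots+k_lt_l$. Then the $Z$ transform of the sequence $n\mapsto F_{t_1sn+m_1}^{k_1}\cdots F_{t_lsn+m_l}^{k_l}$ is $$\mathcal{Z}\left(F_{t_1sn+m_1}^{k_1}\cdots F_{t_lsn+m_l}^{k_l}\right)=z\,\frac{\displaystyle\sum_{i=0}^{K}\sum_{j=0}^{i}(-1)^{\frac{(sj+2(s+1))(j+1)}{2}}\binom{K+1}{j}_{F_s}F_{m_1+t_1s(i-j)}^{k_1}\cdots F_{m_l+t_ls(i-j)}^{k_l}\,y^{\frac{sj(j-1)}{2}}z^{K-i}}{\displaystyle\sum_{i=0}^{K+1}(-1)^{\frac{(si+2(s+1))(i+1)}{2}}\binom{K+1}{i}_{F_s}y^{\frac{si(i-1)}{2}}z^{K+1-i}}.$$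
   Context: $\mathbb{N}=\{1,2,\dots\}$, $\mathbb{N}'=\mathbb{N}\cup\{0\}$. $x,y$ are indeterminates and we abbreviate $F_n=F_n(x,y)$. The bivariate Fibonacci polynomials are $F_0=0$, $F_1=1$, $F_{n+2}=xF_{n+1}+yF_n$, extended to negative indices by $F_{-n}=-(-y)^{-n}F_n$ ($n\in\mathbb{N}$). For $n,k\in\mathbb{N}'$ the bivariate $s$-Fibopolynomial is $\binom{n}{k}_{F_s}=\frac{F_{sn}F_{s(n-1)}\cdots F_{s(n-k+1)}}{F_sF_{2s}\cdots F_{ks}}$ (equal to $1$ for $k=0$ and $k=n$, and to $0$ if $k>n$). The $Z$ transform of a sequence $(a_n)_{n\ge0}$ is $\mathcal{Z}(a_n)=\sum_{n\ge0}a_nz^{-n}$, regarded as a formal power series in $z^{-1}$ with coefficients in $\mathbb{C}(x,y)$ (equivalently, for fixed complex $x,y$ with $y\neq0$, as a function of $z$ for $|z|$ large). Zeroth powers equal $1$. *)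

theory Defs
  imports "HOL-Computational_Algebra.Computational_Algebra"
begin

text \<open>
  The field \<open>\<complex>(x,y)\<close> is the fraction field of \<open>\<complex>[x][y]\<close>: the inner polynomial
  variable is \<open>x\<close>, the outer one is \<open>y\<close>.
\<close>

type_synonym ratfun = "complex poly poly fract"

definition polyX :: "complex poly poly" where
  "polyX = [:[:0, 1:]:]"

definition polyY :: "complex poly poly" where
  "polyY = [:0, 1:]"

fun fib_poly :: "nat \<Rightarrow> complex poly poly" where
  "fib_poly 0 = 0"
| "fib_poly (Suc 0) = 1"
| "fib_poly (Suc (Suc n)) = polyX * fib_poly (Suc n) + polyY * fib_poly n"

definition Y :: ratfun where
  "Y = to_fract polyY"

text \<open>For negative \<open>n\<close>, the \<open>powi\<close> exponent \<open>n\<close> is the \<open>-N\<close> of \<open>F\<^sub>-\<^sub>N = -(-y)\<^sup>-\<^sup>N F\<^sub>N\<close>, \<open>N = -n\<close>.\<close>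

definition Fib :: "int \<Rightarrow> ratfun" where
  "Fib n = (if n \<ge> 0 then to_fract (fib_poly (nat n))
            else - ((- Y) powi n) * to_fract (fib_poly (nat (- n))))"

text \<open>
  The index \<open>n - i\<close> is an integer subtraction; for \<open>k > n\<close> the numerator contains the
  factor \<open>Fib 0 = 0\<close>.
\<close>

definition fibopoly :: "nat \<Rightarrow> nat \<Rightarrow> nat \<Rightarrow> ratfun" where
  "fibopoly s n k = (\<Prod>i<k. Fib (int s * (int n - int i))) / (\<Prod>i=1..k. Fib (int s * int i))"

text \<open>
  Formal power series in \<open>z\<^sup>-\<^sup>1\<close> are taken inside the field of formal Laurent series whose
  variable \<open>fls_X\<close> stands for \<open>z\<^sup>-\<^sup>1\<close>; hence \<open>z\<close> itself is \<open>fls_X_inv\<close>.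
\<close>

abbreviation zvar :: "ratfun fls" where
  "zvar \<equiv> fls_X_inv"

definition Z_transform :: "(nat \<Rightarrow> ratfun) \<Rightarrow> ratfun fls" where
  "Z_transform a = fps_to_fls (Abs_fps a)"

end

theory Submission
  imports Defs "HOL-Algebra.Algebraic_Closure_Type"
begin

text \<open>
  In the algebraic closure of \<open>\<complex>(x,y)\<close> let \<open>\<alpha>, \<beta>\<close> be the roots of \<open>w\<^sup>2 - x w - y\<close> and put
  \<open>p = \<alpha>\<^sup>s\<close>, \<open>q = \<beta>\<^sup>s\<close>. By Binet's formula the given sequence is a combination of the geometric
  sequences with ratios \<open>p\<^sup>i q\<^sup>K\<^sup>-\<^sup>i\<close>, \<open>0 \<le> i \<le> K\<close>. Up to the sign \<open>(-1)\<^sup>s\<^sup>+\<^sup>1\<close> and the factor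
  \<open>z\<^sup>K\<^sup>+\<^sup>1\<close>, the denominator is \<open>\<Prod>\<^sub>i (1 - p\<^sup>i q\<^sup>K\<^sup>-\<^sup>i z\<^sup>-\<^sup>1)\<close> by the q-binomial theorem, so its product
  with the generating function has no coefficients beyond degree \<open>K\<close> in \<open>z\<^sup>-\<^sup>1\<close>; those up to
  degree \<open>K\<close> are the inner sums of the numerator.
\<close>

section \<open>The homogeneous q-binomial theorem\<close>

text \<open>The Gaussian binomial coefficient, homogenized in \<open>p\<close> and \<open>q\<close>;
  at \<open>p = \<alpha> ^ s\<close>, \<open>q = \<beta> ^ s\<close> it becomes the
  Fibopolynomial.\<close>

definition hbinom :: "'a::field \<Rightarrow> 'a \<Rightarrow> nat \<Rightarrow> nat \<Rightarrow> 'a" where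
  "hbinom p q n k = (\<Prod>i<k. p ^ (n - i) - q ^ (n - i)) / (\<Prod>i=1..k. p ^ i - q ^ i)"

lemma hbinom_0 [simp]: "hbinom p q n 0 = 1"
  by (simp add: hbinom_def)

lemma hbinom_eq_0: "n < k \<Longrightarrow> hbinom p q n k = 0"
  by (auto simp: hbinom_def intro!: bexI[of _ n])

lemma hbinom_Suc_right:
  "hbinom p q n (Suc k) =
     hbinom p q n k * (p ^ (n - k) - q ^ (n - k)) / (p ^ Suc k - q ^ Suc k)"
  by (simp add: hbinom_def prod.nat_ivl_Suc')

lemma hbinom_Suc_Suc:
  "hbinom p q (Suc n) (Suc k) =
     hbinom p q n k * (p ^ Suc n - q ^ Suc n) / (p ^ Suc k - q ^ Suc k)"
  by (simp add: hbinom_def prod.nat_ivl_Suc' prod.lessThan_Suc_shift del: prod.lessThan_Suc)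

text \<open>Splitting \<open>p ^ Suc n - q ^ Suc n\<close> as below makes one part supply the next
  factor of the numerator, while the other cancels the last factor of the denominator.\<close>

lemma hbinom_pascal:
  assumes "\<And>i. i \<ge> 1 \<Longrightarrow> p ^ i \<noteq> q ^ i" and "k \<le> n"
  shows "hbinom p q (Suc n) (Suc k) =
    p ^ Suc k * hbinom p q n (Suc k) + q ^ (n - k) * hbinom p q n k"
proof -
  have nz: "p ^ Suc k - q ^ Suc k \<noteq> 0"
    using assms(1)[of "Suc k"] by simp
  obtain d where d: "n = k + d"
    using assms(2) le_Suc_ex by blast
  have "p ^ Suc n - q ^ Suc n =
    p ^ Suc k * (p ^ (n - k) - q ^ (n - k)) + q ^ (n - k) * (p ^ Suc k - q ^ Suc k)"
    by (simp add: d algebra_simps power_add)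
  then have "hbinom p q (Suc n) (Suc k) = hbinom p q n k *
    (p ^ Suc k * (p ^ (n - k) - q ^ (n - k)) + q ^ (n - k) * (p ^ Suc k - q ^ Suc k))
    / (p ^ Suc k - q ^ Suc k)"
    by (simp only: hbinom_Suc_Suc)
  then show ?thesis
    using nz unfolding hbinom_Suc_right
    by (simp add: add_divide_distrib distrib_left mult.commute mult.left_commute del: power_Suc)
qed

definition hbinom_coeff :: "'a::field \<Rightarrow> 'a \<Rightarrow> nat \<Rightarrow> nat \<Rightarrow> 'a" where
  "hbinom_coeff p q n j = (-1) ^ j * (p * q) ^ (j * (j - 1) div 2) * hbinom p q n j"

lemma hbinom_coeff_0 [simp]: "hbinom_coeff p q n 0 = 1"
  by (simp add: hbinom_coeff_def)

text \<open>Compares coefficients of \<open>x ^ Suc j\<close> when the product for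
  \<open>Suc n\<close> at \<open>x\<close> is written as \<open>1 - q ^ n * x\<close> times the
  product for \<open>n\<close> at \<open>p * x\<close>.\<close>

lemma hbinom_coeff_Suc_Suc:
  assumes "\<And>i. i \<ge> 1 \<Longrightarrow> p ^ i \<noteq> q ^ i" and "j \<le> n"
  shows "hbinom_coeff p q (Suc n) (Suc j) =
    p ^ Suc j * hbinom_coeff p q n (Suc j) - q ^ n * p ^ j * hbinom_coeff p q n j"
proof -
  \<comment> \<open>The triangular exponent grows by \<open>j\<close>; the extra
    \<open>q ^ j\<close> turns the \<open>q ^ (n - j)\<close> of Pascal's rule into
    \<open>q ^ n\<close>.\<close>
  have tri: "Suc j * (Suc j - 1) div 2 = j * (j - 1) div 2 + j"
    by (cases j) (auto simp: algebra_simps)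
  have qn: "q ^ n = q ^ j * q ^ (n - j)"
    using assms(2) by (simp flip: power_add)
  have "hbinom p q (Suc n) (Suc j) =
      p ^ Suc j * hbinom p q n (Suc j) + q ^ (n - j) * hbinom p q n j"
    using assms by (rule hbinom_pascal)
  then show ?thesis
    unfolding hbinom_coeff_def tri qn
    by (simp add: power_add power_mult_distrib algebra_simps)
qed

theorem hbinom_theorem:
  assumes "\<And>i. i \<ge> 1 \<Longrightarrow> p ^ i \<noteq> (q :: 'a::field) ^ i"
  shows "(\<Sum>j\<le>n. hbinom_coeff p q n j * x ^ j) = (\<Prod>i<n. 1 - p ^ i * q ^ (n - Suc i) * x)"
\<comment> \<open>\<open>x\<close> is generalized because the induction hypothesis is applied at
  \<open>p * x\<close>.\<close>
proof (induction n arbitrary: x)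
  case 0
  show ?case by simp
next
  case (Suc n)
  let ?c = "hbinom_coeff p q n"
  have top: "?c (Suc n) = 0"
    by (simp add: hbinom_coeff_def hbinom_eq_0)
  have "(\<Sum>j\<le>Suc n. hbinom_coeff p q (Suc n) j * x ^ j) =
      1 + (\<Sum>j\<le>n. hbinom_coeff p q (Suc n) (Suc j) * x ^ Suc j)"
    by (subst sum.atMost_Suc_shift) simp
  also have "(\<Sum>j\<le>n. hbinom_coeff p q (Suc n) (Suc j) * x ^ Suc j) =
      (\<Sum>j\<le>n. ?c (Suc j) * (p * x) ^ Suc j - q ^ n * x * (?c j * (p * x) ^ j))"
    by (intro sum.cong refl)
      (simp add: hbinom_coeff_Suc_Suc[OF assms] power_mult_distrib algebra_simps)
  also have "\<dots> = (\<Sum>j\<le>n. ?c (Suc j) * (p * x) ^ Suc j) - q ^ n * x * (\<Sum>j\<le>n. ?c j * (p * x) ^ j)"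
    by (simp only: sum_subtractf sum_distrib_left)
  also have "1 + \<dots> = (\<Sum>j\<le>Suc n. ?c j * (p * x) ^ j) - q ^ n * x * (\<Sum>j\<le>n. ?c j * (p * x) ^ j)"
    by (subst sum.atMost_Suc_shift) simp
  also have "\<dots> = (1 - q ^ n * x) * (\<Sum>j\<le>n. ?c j * (p * x) ^ j)"
    using top by (simp add: algebra_simps)
  also have "\<dots> = (1 - q ^ n * x) * (\<Prod>i<n. 1 - p ^ Suc i * q ^ (n - Suc i) * x)"
    by (simp only: Suc.IH power_Suc mult.assoc mult.left_commute)
  also have "\<dots> = (\<Prod>i<Suc n. 1 - p ^ i * q ^ (Suc n - Suc i) * x)"
    by (subst prod.lessThan_Suc_shift) simp
  finally show ?case .
qed

text \<open>
  The sequence \<open>f\<close> is a combination of the geometric sequences with ratios \<open>p\<^sup>i q\<^sup>K\<^sup>-\<^sup>i\<close>,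
  whose reciprocals are exactly the zeros of the product in the binomial theorem.
\<close>

lemma hbinom_recurrence:
  fixes G :: "'a::field poly"
  assumes ne: "\<And>i. i \<ge> 1 \<Longrightarrow> p ^ i \<noteq> q ^ i" and nz: "p \<noteq> 0" "q \<noteq> 0"
    and deg: "Polynomial.degree G \<le> K"
    and f: "\<And>n. f n = q ^ (K * n) * poly G ((p / q) ^ n)"
    and n: "n > K"
  shows "(\<Sum>j\<le>Suc K. hbinom_coeff p q (Suc K) j * f (n - j)) = 0"
proof -
  let ?c = "hbinom_coeff p q (Suc K)"
  define w where "w i = p ^ i * q ^ (K - i)" for i
  have w0: "w i \<noteq> 0" for i
    using nz by (simp add: w_def)
  have fw: "f n = (\<Sum>i\<le>K. Polynomial.coeff G i * w i ^ n)" for n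
  proof -
    have G: "poly G x = (\<Sum>i\<le>K. Polynomial.coeff G i * x ^ i)" for x
      unfolding poly_altdef using deg
      by (intro sum.mono_neutral_left) (auto simp: coeff_eq_0)
    have "q ^ (K * n) * (Polynomial.coeff G i * ((p / q) ^ n) ^ i) = Polynomial.coeff G i * w i ^ n"
      if i: "i \<le> K" for i
    proof -
      obtain d where "K = i + d"
        using le_Suc_ex[OF i] by blast
      then show ?thesis
        using nz by (simp add: w_def power_mult_distrib power_divide power_add ring_distribs
            flip: power_mult) (simp add: mult.commute)
    qed
    then show ?thesis
      unfolding f G sum_distrib_left by (intro sum.cong) auto
  qed
  \<comment> \<open>Evaluate the binomial theorem at \<open>inverse (w i)\<close>: the factor with
    index \<open>i\<close> vanishes. Since \<open>n > K\<close>, no \<open>n - j\<close> is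
    truncated.\<close>
  have root: "(\<Sum>j\<le>Suc K. ?c j * w i ^ (n - j)) = 0" if "i \<le> K" for i
  proof -
    have "(\<Sum>j\<le>Suc K. ?c j * w i ^ (n - j)) = (\<Sum>j\<le>Suc K. w i ^ n * (?c j * inverse (w i) ^ j))"
    proof (intro sum.cong refl)
      fix j assume "j \<in> {..Suc K}"
      then have "w i ^ n = w i ^ (n - j) * w i ^ j"
        using n by (simp flip: power_add)
      then show "?c j * w i ^ (n - j) = w i ^ n * (?c j * inverse (w i) ^ j)"
        using w0[of i] by (simp add: field_simps)
    qed
    also have "\<dots> = w i ^ n * (\<Prod>j<Suc K. 1 - p ^ j * q ^ (Suc K - Suc j) * inverse (w i))"
      by (simp only: hbinom_theorem[OF ne] flip: sum_distrib_left)
    also have "(\<Prod>j<Suc K. 1 - p ^ j * q ^ (Suc K - Suc j) * inverse (w i)) = 0"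
      using that w0[of i] by (intro prod_zero) (auto simp flip: w_def intro!: bexI[of _ i])
    finally show ?thesis by simp
  qed
  have "(\<Sum>j\<le>Suc K. ?c j * f (n - j)) = (\<Sum>i\<le>K. Polynomial.coeff G i * (\<Sum>j\<le>Suc K. ?c j * w i ^ (n - j)))"
    unfolding fw sum_distrib_left
    by (subst sum.swap) (simp only: mult.left_commute)
  also have "\<dots> = 0"
    by (intro sum.neutral ballI) (simp only: root atMost_iff mult_zero_right)
  finally show ?thesis .
qed

section \<open>Binet's formula in the algebraic closure\<close>

lemma to_ac_power_int [simp]: "to_ac (x powi n) = to_ac x powi n"
  by (simp add: power_int_def)

text \<open>Setting the outer variable y to 0 leaves a power of x.\<close>

lemma fib_poly_nonzero: "fib_poly (Suc n) \<noteq> 0"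
proof -
  have "poly (fib_poly (Suc n)) 0 = [:0, 1:] ^ n"
    by (induction n rule: fib_poly.induct) (simp_all add: polyX_def polyY_def)
  then show ?thesis
    by (metis poly_0 power_not_zero pCons_eq_0_iff one_neq_zero)
qed

lemma Y_nonzero: "Y \<noteq> 0"
  by (simp add: Y_def polyY_def)

lemma Fib_nonzero: "n > 0 \<Longrightarrow> Fib n \<noteq> 0"
  using fib_poly_nonzero[of "nat n - 1"] by (simp add: Fib_def)

lemma characteristic_roots_exist:
  "\<exists>\<alpha> \<beta>. \<alpha> + \<beta> = to_ac (to_fract polyX) \<and> \<alpha> * \<beta> = to_ac (- Y)"
proof -
  define P :: "ratfun alg_closure poly" where "P = [:to_ac (- Y), - to_ac (to_fract polyX), 1:]"
  have "Polynomial.degree P > 0"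
    by (simp add: P_def)
  then obtain \<alpha> where "poly P \<alpha> = 0"
    using alg_closed_imp_poly_has_root by blast
  then have "\<alpha> * (to_ac (to_fract polyX) - \<alpha>) = to_ac (- Y)"
    by (simp add: P_def algebra_simps)
  then show ?thesis
    by (intro exI[of _ \<alpha>] exI[of _ "to_ac (to_fract polyX) - \<alpha>"]) simp
qed

context
  fixes \<alpha> \<beta> :: "ratfun alg_closure"
  assumes root_sum: "\<alpha> + \<beta> = to_ac (to_fract polyX)"
    and root_prod: "\<alpha> * \<beta> = to_ac (- Y)"
begin

lemma roots_nonzero: "\<alpha> \<noteq> 0" "\<beta> \<noteq> 0"
  using root_prod Y_nonzero by auto

text \<open>The discriminant is x^2 + 4y, whose coefficient at y is the nonzero constant 4.\<close>

lemma roots_distinct: "\<alpha> \<noteq> \<beta>"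
proof
  assume "\<alpha> = \<beta>"
  have "(\<alpha> - \<beta>) ^ 2 = (\<alpha> + \<beta>) ^ 2 - 4 * (\<alpha> * \<beta>)"
    by (simp add: power2_eq_square algebra_simps)
  also have "\<dots> = to_ac (to_fract (polyX ^ 2 + (polyY + polyY + polyY + polyY)))"
    unfolding power2_eq_square to_fract_add to_fract_mult to_ac_add to_ac_mult root_sum root_prod
    by (simp add: Y_def)
  finally have "polyX ^ 2 + (polyY + polyY + polyY + polyY) = 0"
    using \<open>\<alpha> = \<beta>\<close>
    by (simp only: diff_self zero_power2 to_ac_eq_0_iff' to_fract_eq_0_iff)
  then have "Polynomial.coeff (polyX ^ 2 + (polyY + polyY + polyY + polyY)) 1 = 0"
    by simp
  then show False
    by (simp add: polyX_def polyY_def power2_eq_square)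
qed

lemma binet_nat: "(\<alpha> - \<beta>) * to_ac (to_fract (fib_poly n)) = \<alpha> ^ n - \<beta> ^ n"
proof (induction n rule: fib_poly.induct)
  case (3 n)
  have y: "to_ac (to_fract polyY) = - (\<alpha> * \<beta>)"
    by (simp add: root_prod Y_def)
  have "(\<alpha> - \<beta>) * to_ac (to_fract (fib_poly (Suc (Suc n)))) =
    (\<alpha> + \<beta>) * ((\<alpha> - \<beta>) * to_ac (to_fract (fib_poly (Suc n)))) -
    \<alpha> * \<beta> * ((\<alpha> - \<beta>) * to_ac (to_fract (fib_poly n)))"
    by (simp add: y root_sum algebra_simps)
  also have "\<dots> = \<alpha> ^ Suc (Suc n) - \<beta> ^ Suc (Suc n)"
    unfolding 3 by (simp add: algebra_simps)
  finally show ?case .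
qed auto

text \<open>Negative indices fit the same formula because \<open>\<alpha> * \<beta>\<close> is the
  image of \<open>- Y\<close>, so the prefactor \<open>(- Y) powi n\<close> swaps positive powers of
  the roots for negative ones.\<close>

lemma binet: "to_ac (Fib n) = (\<alpha> powi n - \<beta> powi n) / (\<alpha> - \<beta>)"
proof -
  have nat: "to_ac (to_fract (fib_poly N)) = (\<alpha> ^ N - \<beta> ^ N) / (\<alpha> - \<beta>)" for N
    using binet_nat[of N] roots_distinct by (simp add: field_simps)
  show ?thesis
  proof (cases "n \<ge> 0")
    case True
    then show ?thesis
      by (simp add: Fib_def nat power_int_def)
  next
    case False
    define N where "N = nat (- n)"
    have n: "n = - int N"
      using False by (simp add: N_def)
    have "to_ac (Fib n) = - ((\<alpha> * \<beta>) powi n) * (\<alpha> ^ N - \<beta> ^ N) / (\<alpha> - \<beta>)"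
      using False by (simp add: Fib_def nat N_def root_prod)
    also have "- ((\<alpha> * \<beta>) powi n) * (\<alpha> ^ N - \<beta> ^ N) = \<alpha> powi n - \<beta> powi n"
      using roots_nonzero
      by (simp add: n power_int_minus power_mult_distrib field_simps)
    finally show ?thesis .
  qed
qed

text \<open>By Binet, equality would force \<open>Fib n\<close> to vanish. This provides the nonzero
  denominators for the q-binomial theorem.\<close>

lemma root_powers_distinct:
  assumes "n \<ge> 1"
  shows "\<alpha> ^ n \<noteq> \<beta> ^ n"
proof -
  have "to_ac (Fib (int n)) \<noteq> 0"
    using Fib_nonzero[of "int n"] assms by simp
  then show ?thesis
    by (auto simp: binet)
qed

text \<open>Numerator and denominator both have \<open>k\<close> factors, so the powers of
  \<open>\<alpha> - \<beta>\<close> from Binet cancel. The bound on \<open>k\<close> keeps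
  \<open>i \<le> n\<close>, where natural and integer subtraction agree.\<close>

lemma to_ac_fibopoly:
  assumes "k \<le> Suc n"
  shows "to_ac (fibopoly s n k) = hbinom (\<alpha> ^ s) (\<beta> ^ s) n k"
proof -
  have F: "to_ac (Fib (int s * int i)) = ((\<alpha> ^ s) ^ i - (\<beta> ^ s) ^ i) / (\<alpha> - \<beta>)" for i
    by (simp only: binet power_int_of_nat power_mult flip: of_nat_mult)
  have "(\<Prod>i<k. to_ac (Fib (int s * (int n - int i)))) =
    (\<Prod>i<k. ((\<alpha> ^ s) ^ (n - i) - (\<beta> ^ s) ^ (n - i)) / (\<alpha> - \<beta>))"
    using assms by (intro prod.cong refl) (simp add: of_nat_diff flip: F)
  then show ?thesis
    using roots_distinct
    by (simp add: fibopoly_def hbinom_def to_ac_prod F prod_dividef)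
qed

text \<open>Binet with \<open>(\<beta> ^ s) ^ (t * n)\<close> factored out; the remaining polynomial
  has degree at most \<open>t\<close> and does not depend on \<open>n\<close>.\<close>

lemma to_ac_Fib_progression:
  "to_ac (Fib (int t * int s * int n + m)) =
    (\<beta> ^ s) ^ (t * n) * poly (Polynomial.monom (\<alpha> powi m / (\<alpha> - \<beta>)) t - [:\<beta> powi m / (\<alpha> - \<beta>):])
      ((\<alpha> ^ s / \<beta> ^ s) ^ n)"
proof -
  have e: "x powi (int t * int s * int n + m) = (x ^ s) ^ (t * n) * x powi m"
    if "x \<noteq> 0" for x :: "ratfun alg_closure"
  proof -
    have "int t * int s * int n = int (s * (t * n))"
      by simp
    then show ?thesis
      using that by (simp only: power_int_add power_int_of_nat power_mult simp_thms)
  qed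
  have "((\<alpha> ^ s / \<beta> ^ s) ^ n) ^ t * (\<beta> ^ s) ^ (t * n) = (\<alpha> ^ s) ^ (t * n)"
  proof -
    have "((u / v) ^ n) ^ t * v ^ (t * n) = u ^ (t * n)" if "v \<noteq> 0" for u v :: "ratfun alg_closure"
      using that by (simp add: power_divide mult.commute flip: power_mult)
    then show ?thesis
      using roots_nonzero by simp
  qed
  then show ?thesis
    unfolding binet e[OF roots_nonzero(1)] e[OF roots_nonzero(2)]
    by (simp add: poly_monom diff_divide_distrib algebra_simps)
qed

text \<open>Multiplying the polynomials of the single progressions adds their degree bounds; the
  result has the shape that \<open>hbinom_recurrence\<close> expects.\<close>

lemma Fib_product_exponential_form:
  "\<exists>G. Polynomial.degree G \<le> (\<Sum>r\<in>A. k r * t r) \<and>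
    (\<forall>n. to_ac (\<Prod>r\<in>A. Fib (int (t r) * int s * int n + m r) ^ k r) =
      (\<beta> ^ s) ^ ((\<Sum>r\<in>A. k r * t r) * n) * poly G ((\<alpha> ^ s / \<beta> ^ s) ^ n))"
proof -
  define g where
    "g r = Polynomial.monom (\<alpha> powi m r / (\<alpha> - \<beta>)) (t r) - [:\<beta> powi m r / (\<alpha> - \<beta>):]" for r
  have "Polynomial.degree (g r) \<le> t r" for r
    unfolding g_def by (intro degree_diff_le degree_monom_le) simp
  then have "Polynomial.degree (g r ^ k r) \<le> k r * t r" for r
    by (metis degree_power_le le_trans mult.commute mult_le_mono1)
  then have "Polynomial.degree (\<Prod>r\<in>A. g r ^ k r) \<le> (\<Sum>r\<in>A. k r * t r)"
  proof (induction A rule: infinite_finite_induct)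
    case (insert a A)
    then show ?case
      using degree_mult_le[of "g a ^ k a" "\<Prod>r\<in>A. g r ^ k r"]
      by (simp add: add_mono order_trans)
  qed auto
  moreover have "to_ac (\<Prod>r\<in>A. Fib (int (t r) * int s * int n + m r) ^ k r) =
      (\<beta> ^ s) ^ ((\<Sum>r\<in>A. k r * t r) * n) * poly (\<Prod>r\<in>A. g r ^ k r) ((\<alpha> ^ s / \<beta> ^ s) ^ n)" for n
  proof -
    have "to_ac (Fib (int (t r) * int s * int n + m r)) ^ k r =
        (\<beta> ^ s) ^ (k r * t r * n) * poly (g r ^ k r) ((\<alpha> ^ s / \<beta> ^ s) ^ n)" for r
      by (simp only: to_ac_Fib_progression g_def poly_power power_mult_distrib)
        (simp add: mult_ac flip: power_mult)
    then have "to_ac (\<Prod>r\<in>A. Fib (int (t r) * int s * int n + m r) ^ k r) =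
        (\<Prod>r\<in>A. (\<beta> ^ s) ^ (k r * t r * n) * poly (g r ^ k r) ((\<alpha> ^ s / \<beta> ^ s) ^ n))"
      by (simp only: to_ac_prod to_ac_power)
    also have "\<dots> = (\<beta> ^ s) ^ ((\<Sum>r\<in>A. k r * t r) * n) * poly (\<Prod>r\<in>A. g r ^ k r) ((\<alpha> ^ s / \<beta> ^ s) ^ n)"
      by (simp add: prod.distrib poly_prod power_sum sum_distrib_right)
    finally show ?thesis .
  qed
  ultimately show ?thesis
    by blast
qed

end

section \<open>Recurrence and generating function\<close>

definition fibo_coeff :: "nat \<Rightarrow> nat \<Rightarrow> nat \<Rightarrow> ratfun" where
  "fibo_coeff s n j = (-1) ^ (((s * j + 2 * (s + 1)) * (j + 1)) div 2) * fibopoly s n j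
     * Y ^ (s * j * (j - 1) div 2)"

text \<open>With \<open>T = j * (j - 1) div 2\<close> the sign exponent is
  \<open>s * T + j + (s + 1)\<close> up to an even number. The part \<open>s * T\<close> merges with
  the power of \<open>Y\<close>, which gives \<open>hbinom_coeff\<close> up to a sign independent of
  \<open>j\<close>.\<close>

lemma fibo_coeff_eq:
  "fibo_coeff s n j =
    (-1) ^ (s + 1) * ((-1) ^ j * ((- Y) ^ s) ^ (j * (j - 1) div 2) * fibopoly s n j)"
proof -
  define T where "T = j * (j - 1) div 2"
  have T: "j * (j - 1) = 2 * T"
    unfolding T_def by (cases j) auto
  have jj: "j * (j + 1) = 2 * T + 2 * j"
    using T by (cases j) auto
  have "s * j * (j - 1) = 2 * (s * T)"
    using T by (metis mult.assoc mult.left_commute)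
  then have e1: "s * j * (j - 1) div 2 = s * T"
    by (simp only: nonzero_mult_div_cancel_left)
  have "(s * j + 2 * (s + 1)) * (j + 1) = s * (j * (j + 1)) + 2 * ((s + 1) * (j + 1))"
    by (simp add: algebra_simps)
  also have "\<dots> = 2 * (s * T + j + (s + 1) + 2 * (s * j))"
    unfolding jj by (simp add: algebra_simps)
  finally have e2: "(s * j + 2 * (s + 1)) * (j + 1) div 2 = s * T + j + (s + 1) + 2 * (s * j)"
    by simp
  have e4: "(-1) ^ (s * T + j + (s + 1) + 2 * (s * j)) =
      (-1 :: ratfun) ^ (s + 1) * ((-1) ^ j * (-1) ^ (s * T))"
    by (simp add: power_add)
  have e3: "((- Y) ^ s) ^ T = (-1) ^ (s * T) * Y ^ (s * T)"
    by (metis power_minus power_mult)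
  show ?thesis
    unfolding fibo_coeff_def T_def[symmetric] e1 e2 e3 e4
    by (simp only: mult_ac)
qed

lemma fibo_coeff_eq_0:
  assumes "n < j"
  shows "fibo_coeff s n j = 0"
proof -
  have "(\<Prod>i<j. Fib (int s * (int n - int i))) = 0"
    using assms by (intro prod_zero) (auto simp: Fib_def intro!: bexI[of _ n])
  then show ?thesis
    by (simp add: fibo_coeff_def fibopoly_def)
qed

text \<open>The recurrence holds in the algebraic closure and descends because \<open>to_ac\<close>
  is injective; the common sign factors out of the sum.\<close>

lemma Fib_product_recurrence:
  fixes k t :: "nat \<Rightarrow> nat" and m :: "nat \<Rightarrow> int"
  assumes "s \<ge> 1" and n: "n > (\<Sum>r\<in>A. k r * t r)"
  defines "K \<equiv> \<Sum>r\<in>A. k r * t r"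
  defines "a \<equiv> \<lambda>n. \<Prod>r\<in>A. Fib (int (t r) * int s * int n + m r) ^ k r"
  shows "(\<Sum>j\<le>Suc K. fibo_coeff s (Suc K) j * a (n - j)) = 0"
proof -
  obtain \<alpha> \<beta> where roots: "\<alpha> + \<beta> = to_ac (to_fract polyX)" "\<alpha> * \<beta> = to_ac (- Y)"
    using characteristic_roots_exist by blast
  note nz = roots_nonzero[OF roots]
  let ?c = "hbinom_coeff (\<alpha> ^ s) (\<beta> ^ s) (Suc K)"
  obtain G where G: "Polynomial.degree G \<le> K"
    "\<And>n. to_ac (a n) = (\<beta> ^ s) ^ (K * n) * poly G ((\<alpha> ^ s / \<beta> ^ s) ^ n)"
    using Fib_product_exponential_form[OF roots, of k t A s m] unfolding K_def a_def by blast
  have "(\<alpha> ^ s) ^ i \<noteq> (\<beta> ^ s) ^ i" if "i \<ge> 1" for i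
    using root_powers_distinct[OF roots, of "s * i"] assms(1) that by (simp add: power_mult)
  then have rec: "(\<Sum>j\<le>Suc K. ?c j * to_ac (a (n - j))) = 0"
    using nz G n by (intro hbinom_recurrence[where G = G]) (auto simp: K_def)
  have c: "to_ac (fibo_coeff s (Suc K) j) = (-1) ^ (s + 1) * ?c j" if "j \<le> Suc K" for j
    unfolding fibo_coeff_eq hbinom_coeff_def power_mult_distrib[symmetric] roots(2)
    using that by (simp add: to_ac_fibopoly[OF roots])
  have "to_ac (\<Sum>j\<le>Suc K. fibo_coeff s (Suc K) j * a (n - j)) =
      (\<Sum>j\<le>Suc K. (-1) ^ (s + 1) * (?c j * to_ac (a (n - j))))"
    unfolding to_ac_sum by (intro sum.cong refl) (simp only: to_ac_mult c atMost_iff mult.assoc)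
  also have "\<dots> = 0"
    by (simp only: rec flip: sum_distrib_left) simp
  finally show ?thesis
    by (simp only: to_ac_eq_0_iff)
qed

lemma fls_const_sum: "fls_const (\<Sum>x\<in>A. f x) = (\<Sum>x\<in>A. fls_const (f x))"
  by (induction A rule: infinite_finite_induct) (simp_all flip: fls_plus_const)

lemma fps_to_fls_sum: "fps_to_fls (\<Sum>x\<in>A. f x) = (\<Sum>x\<in>A. fps_to_fls (f x))"
  by (induction A rule: infinite_finite_induct) simp_all

text \<open>Translates the descending powers of z in the theorem into a terminating series in the
  inverse of z, using that \<open>zvar\<close> and \<open>fls_X\<close> are inverse to each
  other.\<close>

lemma sum_zvar_power_eq_fps_to_fls:
  assumes "\<And>i. i > N \<Longrightarrow> f $ i = 0"
  shows "(\<Sum>i=0..N. fls_const (f $ i) * zvar ^ (N - i)) = zvar ^ N * fps_to_fls f"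
proof -
  have z: "zvar ^ (N - i) = zvar ^ N * fls_X ^ i" if "i \<le> N" for i
  proof -
    have "zvar ^ N = zvar ^ (N - i) * zvar ^ i"
      using that by (simp flip: power_add)
    then show ?thesis
      by (simp add: mult.assoc flip: power_mult_distrib fls_inverse_X)
  qed
  have f: "f = (\<Sum>i=0..N. fps_const (f $ i) * fps_X ^ i)"
    using assms by (intro fps_ext) (auto simp: fps_sum_nth not_le mult_delta_right)
  have "fps_to_fls f = (\<Sum>i=0..N. fls_const (f $ i) * fls_X ^ i)"
    by (subst f) (simp add: fps_to_fls_sum fls_times_fps_to_fls fps_to_fls_power)
  then show ?thesis
    by (simp add: sum_distrib_left z mult.left_commute)
qed

theorem mainTheorem1:
  fixes s l :: nat and k t :: "nat \<Rightarrow> nat" and m :: "nat \<Rightarrow> int" and K :: nat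
  assumes "s \<ge> 1" and "l \<ge> 1"
    and K: "K = (\<Sum>r=1..l. k r * t r)"
  shows "Z_transform (\<lambda>n. \<Prod>r=1..l. Fib (int (t r) * int s * int n + m r) ^ k r) =
    zvar *
    ((\<Sum>i=0..K. \<Sum>j=0..i.
        fls_const ((-1) ^ (((s * j + 2 * (s + 1)) * (j + 1)) div 2) * fibopoly s (K + 1) j
          * (\<Prod>r=1..l. Fib (m r + int (t r) * int s * (int i - int j)) ^ k r)
          * Y ^ (s * j * (j - 1) div 2))
        * zvar ^ (K - i))
     / (\<Sum>i=0..K + 1.
        fls_const ((-1) ^ (((s * i + 2 * (s + 1)) * (i + 1)) div 2) * fibopoly s (K + 1) i
          * Y ^ (s * i * (i - 1) div 2))
        * zvar ^ (K + 1 - i)))"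
proof -
  define a where "a n = (\<Prod>r=1..l. Fib (int (t r) * int s * int n + m r) ^ k r)" for n
  define D where "D = Abs_fps (fibo_coeff s (Suc K))"
  have a_diff: "(\<Prod>r=1..l. Fib (m r + int (t r) * int s * (int i - int j)) ^ k r) = a (i - j)"
    if "j \<le> i" for i j
    using that by (simp add: a_def of_nat_diff add.commute)
  have D_nth: "D $ i = fibo_coeff s (Suc K) i" for i
    by (simp add: D_def)
  have conv: "(D * Abs_fps a) $ i = (\<Sum>j=0..i. fibo_coeff s (Suc K) j * a (i - j))" for i
    by (simp add: fps_mult_nth D_nth)
  \<comment> \<open>Beyond degree \<open>K\<close> the convolution is exactly the recurrence: terms
    with \<open>j > Suc K\<close> have zero coefficient.\<close>
  have conv_0: "(D * Abs_fps a) $ n = 0" if "n > K" for n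
  proof -
    have "(D * Abs_fps a) $ n = (\<Sum>j\<le>Suc K. fibo_coeff s (Suc K) j * a (n - j))"
      unfolding conv using that
      by (intro sum.mono_neutral_right) (auto simp: fibo_coeff_eq_0)
    also have "\<dots> = 0"
      using Fib_product_recurrence[of s k t "{1..l}" n m] assms(1) that
      unfolding a_def K by simp
    finally show ?thesis .
  qed
  have num: "(\<Sum>i=0..K. \<Sum>j=0..i.
        fls_const ((-1) ^ (((s * j + 2 * (s + 1)) * (j + 1)) div 2) * fibopoly s (K + 1) j
          * (\<Prod>r=1..l. Fib (m r + int (t r) * int s * (int i - int j)) ^ k r)
          * Y ^ (s * j * (j - 1) div 2)) * zvar ^ (K - i)) =
      zvar ^ K * fps_to_fls (D * Abs_fps a)" (is "?num = _")
  proof -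
    have "(-1) ^ (((s * j + 2 * (s + 1)) * (j + 1)) div 2) * fibopoly s (K + 1) j
          * (\<Prod>r=1..l. Fib (m r + int (t r) * int s * (int i - int j)) ^ k r)
          * Y ^ (s * j * (j - 1) div 2) = fibo_coeff s (Suc K) j * a (i - j)" if "j \<le> i" for i j
      unfolding a_diff[OF that] fibo_coeff_def Suc_eq_plus1 by (simp only: mult_ac)
    then have "?num = (\<Sum>i=0..K. fls_const ((D * Abs_fps a) $ i) * zvar ^ (K - i))"
      unfolding conv fls_const_sum sum_distrib_right
      by (intro sum.cong refl) (simp only: atLeastAtMost_iff)
    then show ?thesis
      using sum_zvar_power_eq_fps_to_fls[of K "D * Abs_fps a"] conv_0 by simp
  qed
  have den: "(\<Sum>i=0..K + 1.
        fls_const ((-1) ^ (((s * i + 2 * (s + 1)) * (i + 1)) div 2) * fibopoly s (K + 1) i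
          * Y ^ (s * i * (i - 1) div 2)) * zvar ^ (K + 1 - i)) =
      zvar ^ (K + 1) * fps_to_fls D"
  proof -
    have "D $ i = 0" if "i > K + 1" for i
      using that by (simp add: D_nth fibo_coeff_eq_0)
    from sum_zvar_power_eq_fps_to_fls[OF this] show ?thesis
      by (simp only: D_nth fibo_coeff_def Suc_eq_plus1)
  qed
  \<comment> \<open>The constant term is \<open>(-1) ^ (s + 1)\<close>, so division by the
    denominator is legitimate.\<close>
  have "D $ 0 \<noteq> 0"
    by (simp add: D_nth fibo_coeff_def fibopoly_def)
  then have "fps_to_fls D \<noteq> 0"
    by auto
  \<comment> \<open>The outer factor z makes up for numerator and denominator being scaled by
    \<open>z ^ K\<close> and \<open>z ^ (K + 1)\<close>.\<close>
  moreover have "A = z * (z ^ K * (d * A) / (z ^ (K + 1) * d))"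
    if "z \<noteq> 0" "d \<noteq> 0" for z d A :: "ratfun fls"
    using that by (simp add: field_simps)
  ultimately show ?thesis
    unfolding num den a_def[symmetric] Z_transform_def fls_times_fps_to_fls
    using fls_X_inv_nonzero by blast
qed

end
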